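(* Let $G$ be a finite perfect group, and let $N \in \mathcal{J}(G)$, with associated maps $\gamma$, $\nu$ and operation $\circ$. Let $H = \left(\iota^{-1}(\gamma(G))\right)'$ and $K = \ker(\gamma)$. (1) $G$ is a central product of its subgroups $H$ and $K$, and both $H$ and $K$ are $\operatorname{Aut}(G)$-subgroups of $G$. (2) For $x \in H$ we have $\gamma(x) = \iota(x^{-1})$. (3) $(G, \circ)$ is also a central product of the same subgroups $H$ and $K$. If we represent the elements of $G$ as (equivalence classes of) pairs in $H \times K$, then $$(x, y) \circ (a, b) = (ax, yb).$$ (4) For $(a, b) \in G$, the action of $\nu(a,b)$ on $(x,y) \in G$ is given by $$(x, y)^{\nu(a,b)} = (x,y) \circ (a,b) = (ax, yb),$$ that is, $N$ induces the right regular representation on $K$, and the left regular representation on $H$.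
   Context: A group $G$ is perfect if $G = G'$, where $'$ denotes the derived subgroup. $S(G)$ is the group of all permutations of the set $G$; permutations are written as exponents and composed left-to-right. $\rho : G \to S(G)$ is the right regular representation, $x^{\rho(g)} = xg$, and $\operatorname{Hol}(G) = N_{S(G)}(\rho(G)) = \operatorname{Aut}(G)\rho(G)$. Define $$\mathcal{J}(G) = \{ N \le S(G) : N \text{ is regular}, N \trianglelefteq \operatorname{Hol}(G) \}.$$ For $N \in \mathcal{J}(G)$ and $g \in G$, let $\nu(g)$ be the unique element of $N$ with $1^{\nu(g)} = g$; then $\nu(g) = \gamma(g)\rho(g)$ for a unique $\gamma(g) \in \operatorname{Aut}(G)$, which defines $\gamma : G \to \operatorname{Aut}(G)$. It satisfies $\gamma(gh) = \gamma(h)\gamma(g)$ and $\gamma(g^{\beta}) = \beta^{-1}\gamma(g)\beta$ for $g, h \in G$, $\beta \in \operatorname{Aut}(G)$. The operation $g \circ h = g^{\gamma(h)}h = g^{\nu(h)}$ makes $G$ into a group $(G, \circ)$, and $\nu : (G,\circ) \to N$ is an isomorphism. The map $\iota : G \to \operatorname{Aut}(G)$ is given by $\iota(y) : x \mapsto y^{-1}xy$. $G$ is a central product of subgroups $H$ and $K$ if $G = HK$ and $[H, K] = 1$. An $\operatorname{Aut}(G)$-subgroup of $G$ is an $\operatorname{Aut}(G)$-invariant, that is, characteristic, subgroup. When $G$ is a central product of $H$ and $K$, the pair $(x, y) \in H \times K$ represents the element $xy \in G$; thus pairs stand for equivalence classes, with $(xz, y)$ identified with $(x, zy)$ for $z \in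 H \cap K \le Z(G)$. *)

theory Defs
  imports "HOL-Algebra.Group_Action" "HOL-Algebra.Generated_Groups"
begin

text \<open>Permutations act on the right: the image \<open>x\<close> to the power \<open>f\<close> of a point is
  the application \<open>f x\<close>, and a product \<open>f g\<close> means ``first \<open>f\<close>, then \<open>g\<close>''.
  \<open>BijGroup\<close> composes the other way round, so \<open>sym_group\<close> is its opposite.\<close>

definition sym_group :: "'a set \<Rightarrow> ('a \<Rightarrow> 'a) monoid" where
  "sym_group S =
    \<lparr>carrier = Bij S,
     mult = \<lambda>f g. g \<otimes>\<^bsub>BijGroup S\<^esub> f,
     one = \<one>\<^bsub>BijGroup S\<^esub>\<rparr>"

definition aut_group :: "('a, 'b) monoid_scheme \<Rightarrow> ('a \<Rightarrow> 'a) monoid" where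
  "aut_group G = (sym_group (carrier G)) \<lparr>carrier := auto G\<rparr>"

definition perfect_group :: "('a, 'b) monoid_scheme \<Rightarrow> bool" where
  "perfect_group G \<longleftrightarrow> group G \<and> derived G (carrier G) = carrier G"

definition right_reg :: "('a, 'b) monoid_scheme \<Rightarrow> 'a \<Rightarrow> 'a \<Rightarrow> 'a" where
  "right_reg G g = (\<lambda>x\<in>carrier G. x \<otimes>\<^bsub>G\<^esub> g)"

definition left_reg :: "('a, 'b) monoid_scheme \<Rightarrow> 'a \<Rightarrow> 'a \<Rightarrow> 'a" where
  "left_reg G g = (\<lambda>x\<in>carrier G. g \<otimes>\<^bsub>G\<^esub> x)"

definition holomorph :: "('a, 'b) monoid_scheme \<Rightarrow> ('a \<Rightarrow> 'a) set" where
  "holomorph G = normalizer (sym_group (carrier G)) (right_reg G ` carrier G)"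

definition regular_perms :: "'a set \<Rightarrow> ('a \<Rightarrow> 'a) set \<Rightarrow> bool" where
  "regular_perms S N \<longleftrightarrow>
     (\<forall>x\<in>S. \<forall>y\<in>S. \<exists>f\<in>N. f x = y) \<and>
     (\<forall>x\<in>S. \<forall>f\<in>N. f x = x \<longrightarrow> f = \<one>\<^bsub>sym_group S\<^esub>)"

definition reg_normal_hol :: "('a, 'b) monoid_scheme \<Rightarrow> ('a \<Rightarrow> 'a) set set" where
  "reg_normal_hol G =
     {N. subgroup N (sym_group (carrier G)) \<and>
         regular_perms (carrier G) N \<and>
         N \<lhd> (sym_group (carrier G)) \<lparr>carrier := holomorph G\<rparr>}"

text \<open>Both descriptions below determine a unique object when
  \<open>N \<in> reg_normal_hol G\<close> and \<open>g \<in> carrier G\<close>.\<close>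

definition nu :: "('a, 'b) monoid_scheme \<Rightarrow> ('a \<Rightarrow> 'a) set \<Rightarrow> 'a \<Rightarrow> 'a \<Rightarrow> 'a" where
  "nu G N g = (THE n. n \<in> N \<and> n \<one>\<^bsub>G\<^esub> = g)"

definition gamma :: "('a, 'b) monoid_scheme \<Rightarrow> ('a \<Rightarrow> 'a) set \<Rightarrow> 'a \<Rightarrow> 'a \<Rightarrow> 'a" where
  "gamma G N g =
     (THE \<alpha>. \<alpha> \<in> auto G \<and> nu G N g = \<alpha> \<otimes>\<^bsub>sym_group (carrier G)\<^esub> right_reg G g)"

definition circ_group :: "('a, 'b) monoid_scheme \<Rightarrow> ('a \<Rightarrow> 'a) set \<Rightarrow> 'a monoid" where
  "circ_group G N =
    \<lparr>carrier = carrier G,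
     mult = \<lambda>g h. gamma G N h g \<otimes>\<^bsub>G\<^esub> h,
     one = \<one>\<^bsub>G\<^esub>\<rparr>"

definition iota :: "('a, 'b) monoid_scheme \<Rightarrow> 'a \<Rightarrow> 'a \<Rightarrow> 'a" where
  "iota G y = (\<lambda>x\<in>carrier G. inv\<^bsub>G\<^esub> y \<otimes>\<^bsub>G\<^esub> x \<otimes>\<^bsub>G\<^esub> y)"

definition commutator_subgroup :: "('a, 'b) monoid_scheme \<Rightarrow> 'a set \<Rightarrow> 'a set \<Rightarrow> 'a set" where
  "commutator_subgroup G H K =
     generate G (\<Union>h\<in>H. \<Union>k\<in>K. {h \<otimes>\<^bsub>G\<^esub> k \<otimes>\<^bsub>G\<^esub> inv\<^bsub>G\<^esub> h \<otimes>\<^bsub>G\<^esub> inv\<^bsub>G\<^esub> k})"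

definition central_product :: "('a, 'b) monoid_scheme \<Rightarrow> 'a set \<Rightarrow> 'a set \<Rightarrow> bool" where
  "central_product G H K \<longleftrightarrow>
     group G \<and> subgroup H G \<and> subgroup K G \<and>
     carrier G = H <#>\<^bsub>G\<^esub> K \<and> commutator_subgroup G H K = {\<one>\<^bsub>G\<^esub>}"

definition aut_subgroup :: "('a, 'b) monoid_scheme \<Rightarrow> 'a set \<Rightarrow> bool" where
  "aut_subgroup G H \<longleftrightarrow> subgroup H G \<and> (\<forall>\<alpha>\<in>auto G. \<alpha> ` H = H)"

end

theory Submission
  imports Defs
begin

text \<open>
  Write \<open>c\<close> for \<open>gamma\<close>. Normality of \<open>N\<close> in the holomorph makes \<open>c\<close> a homomorphism
  into the automorphism group that is equivariant under automorphisms. Hence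
  \<open>theta y = c y \<circ> iota y\<close> commutes with every \<open>c g\<close> and is antimultiplicative in \<open>y\<close>.
  Since \<open>theta\<close> and \<open>c\<close> agree on the center, the perfect group \<open>G\<close> acts there through an
  abelian group, that is, trivially; it follows that every \<open>c g\<close> fixes the kernel \<open>Ker\<close> of \<open>c\<close>
  pointwise. As \<open>c h g\<close> is congruent to \<open>h g h\<inverse>\<close> modulo \<open>Ker\<close>, while \<open>(c h g) g\<inverse>\<close>
  centralizes \<open>Ker\<close>, all commutators lie in the product of \<open>Ker\<close> and its centralizer, which is
  therefore \<open>G\<close>. For \<open>y\<close> in the centralizer, \<open>theta y\<close> is a central automorphism, hence trivial,
  so \<open>iota y\<close> lies in the image of \<open>c\<close>. Finally \<open>theta\<close> is trivial on
  \<open>H\<close>, being antimultiplicative with abelian image on the preimage of \<open>c(G)\<close> under \<open>iota\<close>.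
\<close>

section \<open>Actions in which a set of elements acts by commuting maps\<close>

text \<open>The elements acting trivially on \<open>X\<close> form a subgroup, so commutators of
  elements of \<open>L\<close> suffice. Swapping \<open>f a\<close> and \<open>f b\<close> alone
  collapses such a commutator, so \<open>L\<close> may be an arbitrary subset.\<close>

lemma (in group) derived_acts_trivially:
  assumes "L \<subseteq> carrier G"
    and closed: "\<And>g x. \<lbrakk>g \<in> carrier G; x \<in> X\<rbrakk> \<Longrightarrow> f g x \<in> X"
    and one: "\<And>x. x \<in> X \<Longrightarrow> f \<one> x = x"
    and mult: "\<And>g h x. \<lbrakk>g \<in> carrier G; h \<in> carrier G; x \<in> X\<rbrakk> \<Longrightarrow> f (g \<otimes> h) x = f g (f h x)"
    and comm: "\<And>a b x. \<lbrakk>a \<in> L; b \<in> L; x \<in> X\<rbrakk> \<Longrightarrow> f a (f b x) = f b (f a x)"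
    and "g \<in> derived G L" "x \<in> X"
  shows "f g x = x"
proof -
  let ?S = "{g \<in> carrier G. \<forall>x\<in>X. f g x = x}"
  have "subgroup ?S G"
  proof (rule subgroupI)
    show "?S \<noteq> {}" using one by blast
  next
    fix a assume "a \<in> ?S"
    then show "inv a \<in> ?S"
      using mult[of "inv a" a] one by auto
  qed (auto simp: mult)
  moreover have "derived_set G L \<subseteq> ?S"
  proof clarsimp
    fix a b assume ab: "a \<in> L" "b \<in> L"
    then have c: "a \<in> carrier G" "b \<in> carrier G" using assms(1) by auto
    have "f (a \<otimes> b \<otimes> inv a \<otimes> inv b) x = x" if "x \<in> X" for x
    proof -
      have "f (a \<otimes> b \<otimes> inv a \<otimes> inv b) x = f a (f b (f (inv a) (f (inv b) x)))"
        using c that by (simp add: mult closed)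
      also have "\<dots> = f b (f a (f (inv a) (f (inv b) x)))"
        using c ab that by (simp add: comm closed)
      also have "\<dots> = f (b \<otimes> (a \<otimes> (inv a \<otimes> inv b))) x"
        using c that by (simp add: mult closed)
      also have "b \<otimes> (a \<otimes> (inv a \<otimes> inv b)) = \<one>"
        using c by (simp add: m_assoc[symmetric])
      finally show ?thesis using one that by simp
    qed
    then show "a \<otimes> b \<otimes> inv a \<otimes> inv b \<in> carrier G \<and>
        (\<forall>x\<in>X. f (a \<otimes> b \<otimes> inv a \<otimes> inv b) x = x)"
      using c by auto
  qed
  ultimately have "derived G L \<subseteq> ?S"
    unfolding derived_def by (rule generate_subgroup_incl[rotated])
  then show ?thesis using assms(6,7) by auto
qed

section \<open>Permutations with right action, and the holomorph\<close>

lemma sym_group_mult: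
  "\<lbrakk>f \<in> Bij S; g \<in> Bij S\<rbrakk> \<Longrightarrow> f \<otimes>\<^bsub>sym_group S\<^esub> g = compose S g f"
  by (simp add: sym_group_def BijGroup_def)

lemma sym_group_one: "\<one>\<^bsub>sym_group S\<^esub> = (\<lambda>x\<in>S. x)"
  by (simp add: sym_group_def BijGroup_def)

lemma carrier_sym_group [simp]: "carrier (sym_group S) = Bij S"
  by (simp add: sym_group_def)

lemma group_sym_group: "group (sym_group S)"
proof -
  interpret B: group "BijGroup S" by (rule group_BijGroup)
  have c: "carrier (BijGroup S) = Bij S" by (simp add: BijGroup_def)
  show ?thesis
  proof (rule groupI)
    fix x assume x: "x \<in> carrier (sym_group S)"
    have "inv\<^bsub>BijGroup S\<^esub> x \<in> Bij S"
      using x B.inv_closed[unfolded c] by simp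
    moreover have "x \<otimes>\<^bsub>BijGroup S\<^esub> inv\<^bsub>BijGroup S\<^esub> x = \<one>\<^bsub>BijGroup S\<^esub>"
      using x B.r_inv[unfolded c] by simp
    ultimately show "\<exists>y\<in>carrier (sym_group S). y \<otimes>\<^bsub>sym_group S\<^esub> x = \<one>\<^bsub>sym_group S\<^esub>"
      by (auto simp: sym_group_def)
  qed (use B.m_closed B.one_closed B.m_assoc B.r_one in \<open>auto simp: sym_group_def c\<close>)
qed

lemma compose_eqD: "\<lbrakk>compose S f g = compose S h k; x \<in> S\<rbrakk> \<Longrightarrow> f (g x) = h (k x)"
  by (metis compose_eq)

lemma Bij_closed: "\<lbrakk>f \<in> Bij S; x \<in> S\<rbrakk> \<Longrightarrow> f x \<in> S"
  using Bij_imp_funcset by blast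

lemma Bij_eqI: "\<lbrakk>f \<in> Bij S; g \<in> Bij S; \<And>x. x \<in> S \<Longrightarrow> f x = g x\<rbrakk> \<Longrightarrow> f = g"
  by (meson Bij_imp_extensional extensionalityI)

lemma (in group) right_reg_Bij: "g \<in> carrier G \<Longrightarrow> right_reg G g \<in> Bij (carrier G)"
  unfolding Bij_def right_reg_def
  by (auto intro!: bij_betw_byWitness[where f' = "\<lambda>x. x \<otimes> inv g"] simp: m_assoc)

lemma (in group) in_auto_iff:
  "\<alpha> \<in> auto G \<longleftrightarrow> \<alpha> \<in> Bij (carrier G) \<and>
     (\<forall>x\<in>carrier G. \<forall>y\<in>carrier G. \<alpha> (x \<otimes> y) = \<alpha> x \<otimes> \<alpha> y)"
  by (auto simp: auto_def hom_def dest: Bij_imp_funcset)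

text \<open>\<open>normalizer\<close> is a stabilizer under conjugation of sets; multiplying by
  \<open>f\<close> on the right turns this into equality of a left and a right coset, where elements
  can be compared directly.\<close>

lemma (in group) mem_normalizer_iff:
  assumes "R \<subseteq> carrier G"
  shows "f \<in> normalizer G R \<longleftrightarrow> f \<in> carrier G \<and> f <# R = R #> f"
proof -
  have "(f <# R #> inv f = R) = (f <# R = R #> f)" if "f \<in> carrier G"
  proof
    assume "f <# R #> inv f = R"
    then have "(f <# R #> inv f) #> f = R #> f" by simp
    then show "f <# R = R #> f"
      using that assms by (simp add: coset_mult_assoc l_coset_subset_G)
  next
    assume "f <# R = R #> f"
    then show "f <# R #> inv f = R"
      using that assms by (simp add: coset_mult_assoc)
  qed
  then show ?thesis
    using assms by (auto simp: normalizer_def stabilizer_def)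
qed

text \<open>Normalizing the right translations means that each translation by \<open>g\<close>,
  followed by \<open>f\<close>, equals \<open>f\<close> followed by the translation by some
  \<open>c\<close>. Evaluation at \<one> forces \<open>c = inv (f \<one>) \<otimes> f g\<close>,
  which gives the functional equation.\<close>

lemma (in group) mem_holomorph_iff:
  "f \<in> holomorph G \<longleftrightarrow> f \<in> Bij (carrier G) \<and>
     (\<forall>x\<in>carrier G. \<forall>g\<in>carrier G. f (x \<otimes> g) = f x \<otimes> inv (f \<one>) \<otimes> f g)" (is "_ \<longleftrightarrow> ?rhs")
proof -
  let ?S = "carrier G" let ?P = "sym_group ?S" let ?R = "right_reg G ` ?S"
  interpret P: group ?P by (rule group_sym_group)
  have R: "?R \<subseteq> carrier ?P" using right_reg_Bij by auto
  show ?thesis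
    unfolding holomorph_def P.mem_normalizer_iff[OF R]
  proof
    assume f: "f \<in> carrier ?P \<and> f <#\<^bsub>?P\<^esub> ?R = ?R #>\<^bsub>?P\<^esub> f"
    then have fB: "f \<in> Bij ?S" by simp
    show ?rhs
    proof (intro conjI ballI fB)
      fix x g assume x: "x \<in> ?S" and g: "g \<in> ?S"
      have "right_reg G g \<otimes>\<^bsub>?P\<^esub> f \<in> ?R #>\<^bsub>?P\<^esub> f"
        using g by (auto simp: r_coset_def)
      then have "right_reg G g \<otimes>\<^bsub>?P\<^esub> f \<in> f <#\<^bsub>?P\<^esub> ?R" using f by simp
      then obtain c where c: "c \<in> ?S" and "right_reg G g \<otimes>\<^bsub>?P\<^esub> f = f \<otimes>\<^bsub>?P\<^esub> right_reg G c"
        by (auto simp: l_coset_def)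
      then have *: "compose ?S f (right_reg G g) = compose ?S (right_reg G c) f"
        using fB g by (simp add: sym_group_mult right_reg_Bij)
      then have eq: "f (y \<otimes> g) = f y \<otimes> c" if "y \<in> ?S" for y
        using compose_eqD[OF * that] that Bij_closed[OF fB] by (simp add: right_reg_def)
      have "c = inv (f \<one>) \<otimes> f g"
        using eq[of \<one>] g c Bij_closed[OF fB] by (simp add: m_assoc[symmetric])
      then show "f (x \<otimes> g) = f x \<otimes> inv (f \<one>) \<otimes> f g"
        using eq[OF x] x g Bij_closed[OF fB] by (simp add: m_assoc)
    qed
  next
    assume f: ?rhs
    then have fB: "f \<in> Bij ?S" by simp
    note fc = Bij_closed[OF fB]
    have eq: "right_reg G g \<otimes>\<^bsub>?P\<^esub> f = f \<otimes>\<^bsub>?P\<^esub> right_reg G (inv (f \<one>) \<otimes> f g)" if "g \<in> ?S" for g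
    proof -
      let ?c = "inv (f \<one>) \<otimes> f g"
      have c: "?c \<in> ?S" using fc that by simp
      show ?thesis
        unfolding sym_group_mult[OF right_reg_Bij[OF that] fB] sym_group_mult[OF fB right_reg_Bij[OF c]]
        using that f fc by (auto simp: compose_def right_reg_def m_assoc)
    qed
    \<comment> \<open>Since \<open>f\<close> is onto, every translation occurs on the right of
      \<open>f\<close>; this yields equality of the two cosets and not just one inclusion.\<close>
    have "\<exists>g\<in>?S. c = inv (f \<one>) \<otimes> f g" if c: "c \<in> ?S" for c
    proof -
      have "f \<one> \<otimes> c \<in> f ` ?S"
        using fB c fc by (auto simp: Bij_def bij_betw_def)
      then obtain g where g: "g \<in> ?S" and fg: "f \<one> \<otimes> c = f g" by auto
      have "c = inv (f \<one>) \<otimes> (f \<one> \<otimes> c)" using c fc by (simp flip: m_assoc)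
      then show ?thesis using g unfolding fg by blast
    qed
    then have "?S = (\<lambda>g. inv (f \<one>) \<otimes> f g) ` ?S"
      using fc by auto
    then have R': "?R = (\<lambda>g. right_reg G (inv (f \<one>) \<otimes> f g)) ` ?S"
      by (metis image_image)
    have "f <#\<^bsub>?P\<^esub> ?R = (\<Union>g\<in>?S. {f \<otimes>\<^bsub>?P\<^esub> right_reg G (inv (f \<one>) \<otimes> f g)})"
      by (subst R') (simp add: l_coset_def)
    also have "\<dots> = ?R #>\<^bsub>?P\<^esub> f"
      by (simp add: r_coset_def eq)
    finally show "f \<in> carrier ?P \<and> f <#\<^bsub>?P\<^esub> ?R = ?R #>\<^bsub>?P\<^esub> f" using fB by simp
  qed
qed

lemma (in group) auto_in_holomorph:
  assumes "\<alpha> \<in> auto G"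
  shows "\<alpha> \<in> holomorph G"
proof -
  have B: "\<alpha> \<in> Bij (carrier G)"
    and m: "\<And>x y. \<lbrakk>x \<in> carrier G; y \<in> carrier G\<rbrakk> \<Longrightarrow> \<alpha> (x \<otimes> y) = \<alpha> x \<otimes> \<alpha> y"
    using assms by (auto simp: in_auto_iff)
  have "\<alpha> \<one> = \<one>"
    using m[of \<one> \<one>] Bij_closed[OF B, of \<one>] by simp
  then show ?thesis
    using B Bij_closed[OF B] m by (simp add: mem_holomorph_iff)
qed

text \<open>This is the automorphism part in Hol(G) = Aut(G) \<rho>(G): following \<open>f\<close>
  by translation with \<open>inv (f \<one>)\<close> keeps it bijective, and the functional equation
  of the holomorph becomes multiplicativity.\<close>

lemma (in group) holomorph_factor:
  assumes "f \<in> holomorph G"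
  shows "(\<lambda>x\<in>carrier G. f x \<otimes> inv (f \<one>)) \<in> auto G"
proof -
  let ?S = "carrier G" and ?a = "\<lambda>x\<in>carrier G. f x \<otimes> inv (f \<one>)"
  have fB: "f \<in> Bij ?S"
    and fm: "\<And>x g. \<lbrakk>x \<in> ?S; g \<in> ?S\<rbrakk> \<Longrightarrow> f (x \<otimes> g) = f x \<otimes> inv (f \<one>) \<otimes> f g"
    using assms by (auto simp: mem_holomorph_iff)
  note fc = Bij_closed[OF fB]
  have "?a = compose ?S (right_reg G (inv (f \<one>))) f"
    using fc by (auto simp: compose_def right_reg_def)
  then have "?a \<in> Bij ?S"
    using fc by (simp only: compose_Bij[OF right_reg_Bij fB] inv_closed one_closed)
  then show ?thesis
    using fc by (simp add: in_auto_iff fm m_assoc)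
qed

section \<open>Central homomorphisms, commuting elements and automorphisms\<close>

lemma (in group) inv_cancel:
  assumes "x \<in> carrier G" "y \<in> carrier G"
  shows "inv x \<otimes> (x \<otimes> y) = y" and "x \<otimes> (inv x \<otimes> y) = y"
  using assms by (simp_all flip: m_assoc)

text \<open>A homomorphism into the center has abelian image and so kills all commutators. Formally,
  \<open>g\<close> acts by left multiplication with \<open>f g\<close>, and the action is evaluated
  at \<one>.\<close>

lemma (in group) perfect_central_hom_trivial:
  assumes perfect: "derived G (carrier G) = carrier G"
    and closed: "\<And>g. g \<in> carrier G \<Longrightarrow> f g \<in> carrier G"
    and mult: "\<And>g h. \<lbrakk>g \<in> carrier G; h \<in> carrier G\<rbrakk> \<Longrightarrow> f (g \<otimes> h) = f g \<otimes> f h"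
    and central: "\<And>g x. \<lbrakk>g \<in> carrier G; x \<in> carrier G\<rbrakk> \<Longrightarrow> f g \<otimes> x = x \<otimes> f g"
    and g: "g \<in> carrier G"
  shows "f g = \<one>"
proof -
  have "f \<one> \<otimes> f \<one> = f \<one>" using mult[of \<one> \<one>] by simp
  then have f1: "f \<one> = \<one>" using closed[of \<one>] by simp
  have "f g \<otimes> \<one> = \<one>"
  proof (rule derived_acts_trivially[where f = "\<lambda>g. (\<otimes>) (f g)" and L = "carrier G" and X = "carrier G"])
    fix a b x assume "a \<in> carrier G" "b \<in> carrier G" "x \<in> carrier G"
    then show "f a \<otimes> (f b \<otimes> x) = f b \<otimes> (f a \<otimes> x)"
      using central[of a "f b"] closed by (simp flip: m_assoc)
  qed (use perfect g in \<open>auto simp: closed f1 mult m_assoc\<close>)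
  then show ?thesis using closed g by simp
qed

lemma (in group) commuting_product:
  assumes "x \<in> carrier G" "y \<in> carrier G" "a \<in> carrier G" "b \<in> carrier G" "y \<otimes> a = a \<otimes> y"
  shows "(x \<otimes> y) \<otimes> (a \<otimes> b) = (x \<otimes> a) \<otimes> (y \<otimes> b)"
  using assms by (metis m_assoc m_closed)

lemma (in group) commuting_inverse:
  assumes "x \<in> carrier G" "y \<in> carrier G" "y \<otimes> x = x \<otimes> y"
  shows "inv x \<otimes> y = y \<otimes> inv x"
  using assms by (metis inv_closed inv_solve_left inv_solve_right m_assoc m_closed)

lemma (in group) commuting_inv_product:
  assumes "x \<in> carrier G" "y \<in> carrier G" "y \<otimes> x = x \<otimes> y"
  shows "inv (x \<otimes> y) = inv x \<otimes> inv y"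
  using assms by (metis inv_mult_group)

lemma (in group) commuting_set_mult_subgroup:
  assumes H: "subgroup H G" and K: "subgroup K G"
    and comm: "\<And>h k. \<lbrakk>h \<in> H; k \<in> K\<rbrakk> \<Longrightarrow> k \<otimes> h = h \<otimes> k"
  shows "subgroup (H <#> K) G"
proof (rule subgroupI)
  note c = subgroup.mem_carrier[OF H] subgroup.mem_carrier[OF K]
  note cl = subgroup.m_closed[OF H] subgroup.m_closed[OF K]
    subgroup.m_inv_closed[OF H] subgroup.m_inv_closed[OF K]
  show "H <#> K \<subseteq> carrier G" using c by (auto simp: set_mult_def)
  show "H <#> K \<noteq> {}"
    using subgroup.one_closed[OF H] subgroup.one_closed[OF K] by (auto simp: set_mult_def)
  fix a assume "a \<in> H <#> K"
  then obtain h k where h: "h \<in> H" and k: "k \<in> K" and a: "a = h \<otimes> k"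
    by (auto simp: set_mult_def)
  have "inv a = inv h \<otimes> inv k"
    unfolding a by (rule commuting_inv_product) (use h k c comm in auto)
  moreover have "inv h \<in> H" "inv k \<in> K" using h k cl by auto
  ultimately show "inv a \<in> H <#> K" unfolding set_mult_def by blast
  fix b assume "b \<in> H <#> K"
  then obtain h' k' where h': "h' \<in> H" and k': "k' \<in> K" and b: "b = h' \<otimes> k'"
    by (auto simp: set_mult_def)
  have "a \<otimes> b = (h \<otimes> h') \<otimes> (k \<otimes> k')"
    unfolding a b by (rule commuting_product) (use h k h' k' c comm in auto)
  moreover have "h \<otimes> h' \<in> H" "k \<otimes> k' \<in> K" using h k h' k' cl by auto
  ultimately show "a \<otimes> b \<in> H <#> K" unfolding set_mult_def by blast
qed

text \<open>The assumed inclusion, applied to the inverse automorphism, gives the reverse one. The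
  inverse is restricted to the carrier because members of \<open>auto G\<close> are
  extensional.\<close>

lemma (in group) auto_invariantI:
  assumes sub: "A \<subseteq> carrier G" and inv: "\<And>\<alpha>. \<alpha> \<in> auto G \<Longrightarrow> \<alpha> ` A \<subseteq> A" and \<alpha>: "\<alpha> \<in> auto G"
  shows "\<alpha> ` A = A"
proof
  show "A \<subseteq> \<alpha> ` A"
  proof
    fix a assume a: "a \<in> A"
    let ?i = "restrict (inv_into (carrier G) \<alpha>) (carrier G)"
    have B: "\<alpha> \<in> Bij (carrier G)" and h: "\<alpha> \<in> hom G G" using \<alpha> by (auto simp: auto_def)
    have "?i \<in> auto G"
      unfolding auto_def using B h restrict_inv_into_hom restrict_inv_into_Bij by blast
    then have "?i a \<in> A" using inv a by blast
    moreover have "\<alpha> (?i a) = a"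
      using a sub B by (auto simp: Bij_def bij_betw_def f_inv_into_f)
    ultimately show "a \<in> \<alpha> ` A" by force
  qed
qed (use inv \<alpha> in blast)

lemma (in group) iota_auto:
  assumes "y \<in> carrier G" shows "iota G y \<in> auto G"
proof -
  have "iota G y \<in> Bij (carrier G)"
    using conjugation_is_bij[of "inv y"] assms by (simp add: iota_def Bij_def)
  then show ?thesis
    using assms by (simp add: in_auto_iff iota_def m_assoc inv_cancel)
qed

section \<open>Equivariant actions of a group on itself by automorphisms\<close>

text \<open>These are the properties of \<open>gamma\<close> behind the structure of
  \<open>G\<close>. The rule \<gamma>(gh) = \<gamma>(h)\<gamma>(g) for left-to-right products
  becomes a homomorphism law once maps are written to the left of their arguments.\<close>

locale equivariant_gamma = group G for G (structure) +
  fixes c :: "'a \<Rightarrow> 'a \<Rightarrow> 'a"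
  assumes c_auto: "g \<in> carrier G \<Longrightarrow> c g \<in> auto G"
    and c_mult: "\<lbrakk>g \<in> carrier G; h \<in> carrier G; x \<in> carrier G\<rbrakk> \<Longrightarrow> c (g \<otimes> h) x = c g (c h x)"
    and c_equivariant: "\<lbrakk>\<beta> \<in> auto G; g \<in> carrier G; x \<in> carrier G\<rbrakk>
      \<Longrightarrow> c (\<beta> g) (\<beta> x) = \<beta> (c g x)"
begin

lemma c_Bij: "g \<in> carrier G \<Longrightarrow> c g \<in> Bij (carrier G)"
  using c_auto by (simp add: in_auto_iff)

lemma c_closed [simp, intro]: "\<lbrakk>g \<in> carrier G; x \<in> carrier G\<rbrakk> \<Longrightarrow> c g x \<in> carrier G"
  by (rule Bij_closed[OF c_Bij])

lemma c_hom: "\<lbrakk>g \<in> carrier G; x \<in> carrier G; y \<in> carrier G\<rbrakk> \<Longrightarrow> c g (x \<otimes> y) = c g x \<otimes> c g y"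
  using c_auto by (simp add: in_auto_iff)

lemma c_surj:
  assumes "g \<in> carrier G" "x \<in> carrier G"
  shows "\<exists>y\<in>carrier G. x = c g y"
proof -
  have "c g ` carrier G = carrier G"
    using c_Bij[OF assms(1)] by (simp add: Bij_def bij_betw_def)
  then show ?thesis using assms(2) by (metis imageE)
qed

text \<open>An idempotent map that is onto is the identity.\<close>

lemma c_one_left [simp]: "x \<in> carrier G \<Longrightarrow> c \<one> x = x"
  using c_surj[of \<one> x] by (auto simp flip: c_mult)

lemma c_one_right [simp]: "g \<in> carrier G \<Longrightarrow> c g \<one> = \<one>"
  using c_hom[of g \<one> \<one>] by simp

lemma c_inv_right: "\<lbrakk>g \<in> carrier G; x \<in> carrier G\<rbrakk> \<Longrightarrow> c g (inv x) = inv (c g x)"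
  by (rule inv_equality[symmetric]) (simp_all flip: c_hom)

lemma c_inv_left [simp]:
  "\<lbrakk>g \<in> carrier G; x \<in> carrier G\<rbrakk> \<Longrightarrow> c (inv g) (c g x) = x"
  "\<lbrakk>g \<in> carrier G; x \<in> carrier G\<rbrakk> \<Longrightarrow> c g (c (inv g) x) = x"
  by (simp_all flip: c_mult)

text \<open>Conjugation \<open>iota G y\<close> followed by \<open>c y\<close>. On the carrier it is
  the identity exactly when \<open>c y\<close> is conjugation by \<open>inv y\<close>, so it
  measures the failure of the formula wanted on \<open>H\<close>.\<close>

definition theta :: "'a \<Rightarrow> 'a \<Rightarrow> 'a" where
  "theta y x = c y (inv y \<otimes> x \<otimes> y)"

lemma theta_closed [simp, intro]: "\<lbrakk>y \<in> carrier G; x \<in> carrier G\<rbrakk> \<Longrightarrow> theta y x \<in> carrier G"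
  by (simp add: theta_def)

lemma theta_hom:
  "\<lbrakk>y \<in> carrier G; x \<in> carrier G; z \<in> carrier G\<rbrakk> \<Longrightarrow> theta y (x \<otimes> z) = theta y x \<otimes> theta y z"
  by (simp add: theta_def m_assoc inv_cancel flip: c_hom)

lemma theta_one: "x \<in> carrier G \<Longrightarrow> theta \<one> x = x"
  by (simp add: theta_def)

text \<open>Rewriting \<open>g \<otimes> y\<close> as
  \<open>y \<otimes> (inv y \<otimes> g \<otimes> y)\<close> moves \<open>c g\<close> past
  \<open>c y\<close> at the cost of conjugating \<open>g\<close> by \<open>y\<close>; equivariance
  under \<open>iota G y\<close> undoes that conjugation.\<close>

lemma c_theta_commute:
  assumes "g \<in> carrier G" "y \<in> carrier G" "x \<in> carrier G"
  shows "c g (theta y x) = theta y (c g x)"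
proof -
  have "c g (theta y x) = c (y \<otimes> (inv y \<otimes> g \<otimes> y)) (inv y \<otimes> x \<otimes> y)"
    using assms by (simp add: theta_def m_assoc inv_cancel flip: c_mult)
  also have "\<dots> = c y (c (inv y \<otimes> g \<otimes> y) (inv y \<otimes> x \<otimes> y))"
    using assms by (simp add: c_mult)
  also have "c (inv y \<otimes> g \<otimes> y) (inv y \<otimes> x \<otimes> y) = inv y \<otimes> c g x \<otimes> y"
    using c_equivariant[OF iota_auto, of y g x] assms by (simp add: iota_def)
  finally show ?thesis by (simp add: theta_def)
qed

text \<open>The inner factor of \<open>theta (y \<otimes> z)\<close> is \<open>theta z\<close>, and
  \<open>c y\<close> passes through it by \<open>c_theta_commute\<close>; hence the order is
  reversed.\<close>

lemma theta_mult:
  assumes "y \<in> carrier G" "z \<in> carrier G" "x \<in> carrier G"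
  shows "theta (y \<otimes> z) x = theta z (theta y x)"
proof -
  have "theta (y \<otimes> z) x = c y (theta z (inv y \<otimes> x \<otimes> y))"
    using assms by (simp add: theta_def c_mult inv_mult_group m_assoc)
  also have "\<dots> = theta z (theta y x)"
    using assms by (simp add: c_theta_commute) (simp add: theta_def)
  finally show ?thesis .
qed

definition Ker :: "'a set" where
  "Ker = {k \<in> carrier G. \<forall>x\<in>carrier G. c k x = x}"

lemma Ker_carrier: "k \<in> Ker \<Longrightarrow> k \<in> carrier G"
  by (simp add: Ker_def)

lemma Ker_subgroup: "subgroup Ker G"
proof (rule subgroupI)
  show "Ker \<noteq> {}" by (auto simp: Ker_def)
  fix a assume "a \<in> Ker"
  then show "inv a \<in> Ker"
    using c_inv_left(1)[of a] by (auto simp: Ker_def)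
qed (auto simp: Ker_def c_mult)

lemma Ker_auto:
  assumes \<beta>: "\<beta> \<in> auto G" and k: "k \<in> Ker"
  shows "\<beta> k \<in> Ker"
proof -
  have B: "\<beta> \<in> Bij (carrier G)" using \<beta> by (simp add: in_auto_iff)
  have "c (\<beta> k) x = x" if x: "x \<in> carrier G" for x
  proof -
    obtain y where "y \<in> carrier G" "x = \<beta> y" using B x by (auto simp: Bij_def bij_betw_def)
    then show ?thesis using c_equivariant[OF \<beta>, of k y] k by (simp add: Ker_def)
  qed
  then show ?thesis using Bij_closed[OF B] k by (simp add: Ker_def)
qed

lemma Ker_conj: "\<lbrakk>k \<in> Ker; g \<in> carrier G\<rbrakk> \<Longrightarrow> inv g \<otimes> k \<otimes> g \<in> Ker"
  using Ker_auto[OF iota_auto, of g k] by (simp add: iota_def Ker_carrier)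

text \<open>Equivariance under the automorphism \<open>c h\<close> shows that
  \<open>c (c h g)\<close> is \<open>c g\<close> conjugated by \<open>c h\<close>. So
  \<open>c h g\<close> and \<open>h \<otimes> g \<otimes> inv h\<close> have the same image under
  \<open>c\<close>.\<close>

lemma c_conj_mod_Ker:
  assumes h: "h \<in> carrier G" and g: "g \<in> carrier G"
  shows "h \<otimes> g \<otimes> inv h \<otimes> inv (c h g) \<in> Ker"
proof -
  have "c (h \<otimes> g \<otimes> inv h) x = c (c h g) x" if x: "x \<in> carrier G" for x
    using c_equivariant[OF c_auto[OF h] g, of "c (inv h) x"] x h g by (simp add: c_mult)
  then show ?thesis
    using assms by (simp add: Ker_def c_mult[of "h \<otimes> g \<otimes> inv h"])
qed

definition Cen :: "'a set" where
  "Cen = {z \<in> carrier G. \<forall>x\<in>carrier G. x \<otimes> z = z \<otimes> x}"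

lemma c_Cen_closed:
  assumes g: "g \<in> carrier G" and z: "z \<in> Cen"
  shows "c g z \<in> Cen"
proof -
  have "x \<otimes> c g z = c g z \<otimes> x" if x: "x \<in> carrier G" for x
  proof -
    obtain y where "y \<in> carrier G" "x = c g y" using c_surj[OF g x] by blast
    then show ?thesis using g z c_hom[of g y z] c_hom[of g z y] by (auto simp: Cen_def)
  qed
  then show ?thesis using assms by (auto simp: Cen_def)
qed

lemma theta_Cen: "\<lbrakk>y \<in> carrier G; z \<in> Cen\<rbrakk> \<Longrightarrow> theta y z = c y z"
  by (auto simp: theta_def Cen_def m_assoc inv_cancel)

end

section \<open>Perfect groups: the factors \<open>derived G L\<close> and \<open>Ker\<close>\<close>

locale perfect_gamma = equivariant_gamma +
  assumes perfect: "derived G (carrier G) = carrier G"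
begin

text \<open>On the center \<open>theta b\<close> coincides with \<open>c b\<close>, so
  \<open>c_theta_commute\<close> makes all the maps \<open>c a\<close> commute there, and a perfect
  group acts trivially through commuting maps.\<close>

lemma c_Cen:
  assumes g: "g \<in> carrier G" and z: "z \<in> Cen"
  shows "c g z = z"
proof (rule derived_acts_trivially[where L = "carrier G" and X = Cen and f = c])
  fix a b x assume a: "a \<in> carrier G" and b: "b \<in> carrier G" and x: "x \<in> Cen"
  have "c a (c b x) = c a (theta b x)" using theta_Cen b x by simp
  also have "\<dots> = theta b (c a x)" using c_theta_commute a b x by (simp add: Cen_def)
  also have "\<dots> = c b (c a x)" using theta_Cen c_Cen_closed a b x by simp
  finally show "c a (c b x) = c b (c a x)" .
qed (use g z perfect c_Cen_closed in \<open>auto simp: Cen_def c_mult\<close>)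

text \<open>For \<open>k\<close> in \<open>Ker\<close> the map \<open>theta k\<close> is conjugation
  by \<open>k\<close>. Since it commutes with \<open>c g\<close>, which is onto, conjugation by
  \<open>c g k\<close> and by \<open>k\<close> agree.\<close>

lemma c_Ker_mod_Cen:
  assumes g: "g \<in> carrier G" and k: "k \<in> Ker"
  shows "c g k \<otimes> inv k \<in> Cen"
proof -
  note kc = Ker_carrier[OF k]
  have "x \<otimes> (c g k \<otimes> inv k) = (c g k \<otimes> inv k) \<otimes> x" if "x \<in> carrier G" for x
  proof -
    obtain y where y: "y \<in> carrier G" "x = c g y" using c_surj g \<open>x \<in> carrier G\<close> by auto
    have th: "theta k u = inv k \<otimes> u \<otimes> k" if "u \<in> carrier G" for u
      using k kc that by (simp add: theta_def Ker_def)
    have "inv (c g k) \<otimes> x \<otimes> c g k = inv k \<otimes> x \<otimes> k"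
      using c_theta_commute[OF g kc y(1)] g kc y by (simp add: th c_hom c_inv_right)
    then have "c g k \<otimes> (inv (c g k) \<otimes> x \<otimes> c g k) \<otimes> inv k = c g k \<otimes> (inv k \<otimes> x \<otimes> k) \<otimes> inv k"
      by simp
    then show ?thesis using g kc that by (simp add: m_assoc inv_cancel)
  qed
  then show ?thesis using g kc by (auto simp: Cen_def)
qed

text \<open>The quotient \<open>c a k \<otimes> inv k\<close> is central, and its dependence on
  \<open>a\<close> is multiplicative because \<open>c\<close> fixes the center; perfectness makes it
  trivial.\<close>

lemma c_Ker:
  assumes g: "g \<in> carrier G" and k: "k \<in> Ker"
  shows "c g k = k"
proof -
  note kc = Ker_carrier[OF k]
  have "c g k \<otimes> inv k = \<one>"
  proof (rule perfect_central_hom_trivial[OF perfect, where f = "\<lambda>a. c a k \<otimes> inv k"])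
    fix a b assume a: "a \<in> carrier G" and b: "b \<in> carrier G"
    let ?z = "c b k \<otimes> inv k"
    have z: "?z \<in> Cen" by (rule c_Ker_mod_Cen[OF b k])
    \<comment> \<open>Writing \<open>c b k\<close> as \<open>?z \<otimes> k\<close> isolates a
      central factor that \<open>c a\<close> leaves unchanged.\<close>
    have "c (a \<otimes> b) k = c a (?z \<otimes> k)"
      using a b kc by (simp add: c_mult m_assoc)
    also have "\<dots> = c a ?z \<otimes> c a k"
      using a b kc by (intro c_hom) auto
    also have "c a ?z = ?z" by (rule c_Cen[OF a z])
    also have "?z \<otimes> c a k = c a k \<otimes> ?z"
      using z a kc by (simp add: Cen_def)
    finally have "c (a \<otimes> b) k \<otimes> inv k = c a k \<otimes> (?z \<otimes> inv k)"
      using a b kc by (simp add: m_assoc)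
    also have "?z \<otimes> inv k = inv k \<otimes> ?z"
      using z kc by (simp add: Cen_def)
    finally show "c (a \<otimes> b) k \<otimes> inv k = (c a k \<otimes> inv k) \<otimes> ?z"
      using a b kc by (simp add: m_assoc)
  next
    fix a x assume "a \<in> carrier G" "x \<in> carrier G"
    then show "c a k \<otimes> inv k \<otimes> x = x \<otimes> (c a k \<otimes> inv k)"
      using c_Ker_mod_Cen[of a k] k by (simp add: Cen_def)
  qed (use g kc in auto)
  then show ?thesis using g kc by (metis c_closed inv_closed inv_equality inv_inv)
qed

definition CKer :: "'a set" where
  "CKer = {x \<in> carrier G. \<forall>k\<in>Ker. k \<otimes> x = x \<otimes> k}"

lemma CKer_subgroup: "subgroup CKer G"
proof (rule subgroupI)
  show "CKer \<noteq> {}" by (auto simp: CKer_def Ker_carrier intro!: exI[of _ \<one>])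
  fix a assume a: "a \<in> CKer"
  then show "inv a \<in> CKer"
    using commuting_inverse[of a] by (auto simp: CKer_def Ker_carrier)
  fix b assume b: "b \<in> CKer"
  have "k \<otimes> (a \<otimes> b) = a \<otimes> b \<otimes> k" if k: "k \<in> Ker" for k
  proof -
    have c: "k \<in> carrier G" "a \<in> carrier G" "b \<in> carrier G"
      and ka: "k \<otimes> a = a \<otimes> k" and kb: "k \<otimes> b = b \<otimes> k"
      using a b k Ker_carrier[OF k] by (auto simp: CKer_def)
    have "k \<otimes> (a \<otimes> b) = a \<otimes> k \<otimes> b" using c by (simp add: ka flip: m_assoc)
    also have "\<dots> = a \<otimes> b \<otimes> k" using c by (simp add: kb m_assoc)
    finally show ?thesis .
  qed
  then show "a \<otimes> b \<in> CKer" using a b by (simp add: CKer_def)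
qed (auto simp: CKer_def)

text \<open>As \<open>Ker\<close> is normal, \<open>f\<close> fixes both \<open>k\<close> and its
  conjugate by \<open>x\<close>. Applying \<open>f\<close> to
  \<open>k \<otimes> x = x \<otimes> (inv x \<otimes> k \<otimes> x)\<close> shows that
  \<open>f x\<close> and \<open>x\<close> conjugate \<open>Ker\<close> in the same way.\<close>

lemma hom_fixing_Ker:
  assumes closed: "\<And>x. x \<in> carrier G \<Longrightarrow> f x \<in> carrier G"
    and hom: "\<And>x y. \<lbrakk>x \<in> carrier G; y \<in> carrier G\<rbrakk> \<Longrightarrow> f (x \<otimes> y) = f x \<otimes> f y"
    and fixed: "\<And>k. k \<in> Ker \<Longrightarrow> f k = k"
    and x: "x \<in> carrier G"
  shows "f x \<otimes> inv x \<in> CKer"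
proof -
  have "k \<otimes> (f x \<otimes> inv x) = (f x \<otimes> inv x) \<otimes> k" if k: "k \<in> Ker" for k
  proof -
    note kc = Ker_carrier[OF k] and k' = Ker_conj[OF k x]
    have "k \<otimes> f x = f (k \<otimes> x)" using hom fixed k kc x by simp
    also have "k \<otimes> x = x \<otimes> (inv x \<otimes> k \<otimes> x)"
      using kc x by (simp add: m_assoc inv_cancel)
    also have "f \<dots> = f x \<otimes> (inv x \<otimes> k \<otimes> x)"
      using hom[OF x Ker_carrier[OF k']] fixed[OF k'] by simp
    finally have "k \<otimes> f x \<otimes> inv x = f x \<otimes> (inv x \<otimes> k \<otimes> x) \<otimes> inv x" by simp
    then show ?thesis using kc x closed by (simp add: m_assoc)
  qed
  then show ?thesis using closed x by (auto simp: CKer_def)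
qed

text \<open>By perfectness only commutators need to be placed in the product, which is a subgroup
  because the two factors commute.\<close>

lemma carrier_CKer_Ker: "carrier G = CKer <#> Ker"
proof
  have S: "subgroup (CKer <#> Ker) G"
    by (rule commuting_set_mult_subgroup[OF CKer_subgroup Ker_subgroup]) (auto simp: CKer_def)
  then show "CKer <#> Ker \<subseteq> carrier G" by (rule subgroup.subset)
  have "derived_set G (carrier G) \<subseteq> CKer <#> Ker"
  proof clarify
    fix h g assume h: "h \<in> carrier G" and g: "g \<in> carrier G"
    \<comment> \<open>The commutator of \<open>h\<close> and \<open>g\<close> telescopes through
      \<open>c h g\<close> as \<open>?k \<otimes> ?d\<close>; \<open>?d\<close> centralizes
      \<open>Ker\<close> because \<open>c h\<close> fixes \<open>Ker\<close> pointwise.\<close>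
    let ?d = "c h g \<otimes> inv g" and ?k = "h \<otimes> g \<otimes> inv h \<otimes> inv (c h g)"
    have d: "?d \<in> CKer"
      by (rule hom_fixing_Ker) (use h g in \<open>auto simp: c_hom c_Ker\<close>)
    have k: "?k \<in> Ker" by (rule c_conj_mod_Ker[OF h g])
    have "h \<otimes> g \<otimes> inv h \<otimes> inv g = ?k \<otimes> ?d"
      using h g by (simp add: m_assoc inv_cancel)
    also have "\<dots> = ?d \<otimes> ?k" using d k by (simp add: CKer_def)
    finally show "h \<otimes> g \<otimes> inv h \<otimes> inv g \<in> CKer <#> Ker"
      using d k by (auto simp: set_mult_def)
  qed
  then have "derived G (carrier G) \<subseteq> CKer <#> Ker"
    unfolding derived_def using S by (rule generate_subgroup_incl)
  then show "carrier G \<subseteq> CKer <#> Ker" using perfect by simp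
qed

text \<open>Membership in \<open>Ker\<close> gives commutation with \<open>CKer\<close> and vice
  versa, and these two subgroups together make up \<open>G\<close>.\<close>

lemma Ker_CKer_Cen:
  assumes "z \<in> Ker" "z \<in> CKer"
  shows "z \<in> Cen"
proof -
  have "x \<otimes> z = z \<otimes> x" if "x \<in> carrier G" for x
  proof -
    from that obtain a k where a: "a \<in> CKer" and k: "k \<in> Ker" and x: "x = a \<otimes> k"
      unfolding carrier_CKer_Ker by (auto simp: set_mult_def)
    have "a \<in> carrier G" "k \<otimes> z = z \<otimes> k" "z \<otimes> a = a \<otimes> z"
      using a k assms by (auto simp: CKer_def)
    then show ?thesis
      unfolding x using Ker_carrier[OF k] Ker_carrier[OF assms(1)] by (metis m_assoc)
  qed
  then show ?thesis using assms Ker_carrier by (simp add: Cen_def)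
qed

text \<open>The deviation \<open>theta y x \<otimes> inv x\<close> lies in both \<open>Ker\<close>
  and \<open>CKer\<close>, hence in the center. A central deviation of a homomorphism from the
  identity is multiplicative in \<open>x\<close>, so perfectness kills it.\<close>

lemma theta_CKer:
  assumes y: "y \<in> CKer" and x: "x \<in> carrier G"
  shows "theta y x = x"
proof -
  have yc: "y \<in> carrier G" using y by (simp add: CKer_def)
  have z: "theta y x \<otimes> inv x \<in> Cen" if x: "x \<in> carrier G" for x
  proof (rule Ker_CKer_Cen)
    \<comment> \<open>Modulo \<open>Ker\<close>, \<open>c y\<close> is conjugation by
      \<open>inv y\<close> and cancels the conjugation inside \<open>theta\<close>. The outer
      inverse turns \<open>x \<otimes> inv (theta y x)\<close> into the required quotient.\<close>
    have "inv (y \<otimes> (inv y \<otimes> x \<otimes> y) \<otimes> inv y \<otimes> inv (theta y x)) \<in> Ker"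
      unfolding theta_def
      by (intro subgroup.m_inv_closed[OF Ker_subgroup] c_conj_mod_Ker) (use x yc in auto)
    then show "theta y x \<otimes> inv x \<in> Ker"
      using x yc by (simp add: m_assoc inv_mult_group inv_cancel)
    show "theta y x \<otimes> inv x \<in> CKer"
    proof (rule hom_fixing_Ker[where f = "theta y"])
      fix k assume k: "k \<in> Ker"
      then have "inv y \<otimes> k \<otimes> y = k"
        using y yc Ker_carrier[OF k] by (simp add: CKer_def m_assoc inv_cancel)
      then show "theta y k = k" using c_Ker[OF yc k] by (simp add: theta_def)
    qed (use x yc in \<open>auto simp: theta_hom\<close>)
  qed
  have "theta y x \<otimes> inv x = \<one>"
  proof (rule perfect_central_hom_trivial[OF perfect, where f = "\<lambda>a. theta y a \<otimes> inv a"])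
    fix a b assume a: "a \<in> carrier G" and b: "b \<in> carrier G"
    have "theta y (a \<otimes> b) \<otimes> inv (a \<otimes> b) = theta y a \<otimes> ((theta y b \<otimes> inv b) \<otimes> inv a)"
      using a b yc by (simp add: theta_hom inv_mult_group m_assoc)
    also have "(theta y b \<otimes> inv b) \<otimes> inv a = inv a \<otimes> (theta y b \<otimes> inv b)"
      using z[OF b] a by (simp add: Cen_def)
    finally show "theta y (a \<otimes> b) \<otimes> inv (a \<otimes> b) = (theta y a \<otimes> inv a) \<otimes> (theta y b \<otimes> inv b)"
      using a b yc by (simp add: m_assoc)
  next
    fix a u assume "a \<in> carrier G" "u \<in> carrier G"
    then show "theta y a \<otimes> inv a \<otimes> u = u \<otimes> (theta y a \<otimes> inv a)"
      using z[of a] by (simp add: Cen_def)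
  qed (use x yc in auto)
  then show ?thesis using x yc by (metis theta_closed inv_closed inv_equality inv_inv)
qed

text \<open>The preimage under \<open>iota\<close> of the image of \<open>c\<close>; its derived
  subgroup is the factor \<open>H\<close> of the theorem.\<close>

definition L :: "'a set" where
  "L = {y \<in> carrier G. iota G y \<in> c ` carrier G}"

lemma L_carrier: "L \<subseteq> carrier G"
  by (auto simp: L_def)

text \<open>Triviality of \<open>theta y\<close> exhibits \<open>iota G y\<close> as
  \<open>c (inv y)\<close>.\<close>

lemma CKer_L: "CKer \<subseteq> L"
proof
  fix y assume y: "y \<in> CKer"
  then have yc: "y \<in> carrier G" by (simp add: CKer_def)
  have "iota G y = c (inv y)"
  proof (rule Bij_eqI)
    show "iota G y \<in> Bij (carrier G)" "c (inv y) \<in> Bij (carrier G)"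
      using yc iota_auto c_Bij by (auto simp: in_auto_iff)
    fix x assume x: "x \<in> carrier G"
    have "c (inv y) x = c (inv y) (theta y x)" using theta_CKer y x by simp
    also have "\<dots> = inv y \<otimes> x \<otimes> y" using x yc by (simp add: theta_def)
    finally show "iota G y x = c (inv y) x" using x by (simp add: iota_def)
  qed
  then show "y \<in> L" using yc by (auto simp: L_def)
qed

text \<open>If \<open>iota G a = c g\<close>, then \<open>theta a\<close> is \<open>c g\<close>
  followed by \<open>c a\<close>, and both commute with every \<open>theta b\<close>. Thus
  \<open>L\<close> acts through commuting maps and \<open>theta\<close> is trivial on
  \<open>derived G L\<close>.\<close>

lemma c_derived_L:
  assumes x: "x \<in> derived G L" and u: "u \<in> carrier G"
  shows "c x u = x \<otimes> u \<otimes> inv x"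
proof -
  have S: "subgroup (derived G L) G" by (rule derived_is_subgroup[OF L_carrier])
  have xc: "x \<in> carrier G" using subgroup.mem_carrier[OF S x] .
  have comm: "theta a (theta b v) = theta b (theta a v)"
    if a: "a \<in> L" and b: "b \<in> carrier G" and v: "v \<in> carrier G" for a b v
  proof -
    obtain g where g: "g \<in> carrier G" and ag: "iota G a = c g" and ac: "a \<in> carrier G"
      using a by (auto simp: L_def)
    have "theta a w = c a (c g w)" if "w \<in> carrier G" for w
      unfolding ag[symmetric] using that by (simp add: theta_def iota_def)
    then show ?thesis using ac b v g by (simp add: c_theta_commute)
  qed
  \<comment> \<open>As \<open>theta\<close> reverses products,
    \<open>\<lambda>y. theta (inv y)\<close> is an action. It is evaluated for \<open>inv x\<close>
    at the point where \<open>theta x\<close> takes the value \<open>c x u\<close>.\<close>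
  have "theta (inv (inv x)) (x \<otimes> u \<otimes> inv x) = x \<otimes> u \<otimes> inv x"
  proof (rule derived_acts_trivially[OF L_carrier, where X = "carrier G" and f = "\<lambda>y. theta (inv y)"])
    fix a b v assume a: "a \<in> L" and b: "b \<in> L" and v: "v \<in> carrier G"
    have ac: "a \<in> carrier G" and bc: "b \<in> carrier G" using a b L_carrier by auto
    have inv: "theta y (theta (inv y) w) = w" "theta (inv y) (theta y w) = w"
      if "y \<in> carrier G" "w \<in> carrier G" for y w
      using that theta_mult[of "inv y" y w] theta_mult[of y "inv y" w] by (auto simp: theta_one)
    \<comment> \<open>Commutation of \<open>theta a\<close> and \<open>theta b\<close> is
      transferred to their inverse maps by inserting cancelling pairs.\<close>
    have "theta (inv b) (theta (inv a) v) = theta (inv b) (theta (inv a) (theta b (theta (inv b) v)))"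
      using inv bc v by simp
    also have "theta b (theta (inv b) v) = theta b (theta a (theta (inv a) (theta (inv b) v)))"
      using inv ac bc v by simp
    also have "\<dots> = theta a (theta b (theta (inv a) (theta (inv b) v)))"
      using comm[OF b ac] ac bc v by simp
    finally show "theta (inv a) (theta (inv b) v) = theta (inv b) (theta (inv a) v)"
      using inv ac bc v by simp
  qed (use x u xc subgroup.m_inv_closed[OF S] in \<open>auto simp: theta_one theta_mult inv_mult_group\<close>)
  then show ?thesis
    using xc u by (simp add: theta_def m_assoc inv_cancel)
qed

text \<open>The value \<open>c h k\<close> is the conjugate
  \<open>h \<otimes> k \<otimes> inv h\<close> by \<open>c_derived_L\<close> and equals
  \<open>k\<close> by \<open>c_Ker\<close>.\<close>

lemma derived_L_Ker_commute:
  assumes h: "h \<in> derived G L" and k: "k \<in> Ker"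
  shows "k \<otimes> h = h \<otimes> k"
proof -
  have hc: "h \<in> carrier G" using h derived_in_carrier[OF L_carrier] by auto
  have "k = h \<otimes> k \<otimes> inv h"
    using c_derived_L[OF h] c_Ker[OF hc k] Ker_carrier[OF k] by simp
  then show ?thesis using hc Ker_carrier[OF k] by (metis inv_solve_right m_closed)
qed

text \<open>With both entries factored through \<open>CKer\<close> and \<open>Ker\<close>, a
  commutator splits into a commutator in \<open>CKer\<close>, which lies in
  \<open>derived G L\<close> since \<open>CKer\<close> is inside \<open>L\<close>, and one in
  \<open>Ker\<close>. Perfectness then gives all of \<open>G\<close>.\<close>

lemma carrier_derived_L_Ker: "carrier G = derived G L <#> Ker"
proof
  have S: "subgroup (derived G L <#> Ker) G"
    using commuting_set_mult_subgroup[OF derived_is_subgroup[OF L_carrier] Ker_subgroup]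
      derived_L_Ker_commute by simp
  then show "derived G L <#> Ker \<subseteq> carrier G" by (rule subgroup.subset)
  have "derived_set G (carrier G) \<subseteq> derived G L <#> Ker"
  proof clarify
    fix g h assume "g \<in> carrier G" "h \<in> carrier G"
    then obtain a k b l where a: "a \<in> CKer" and k: "k \<in> Ker" and g: "g = a \<otimes> k"
      and b: "b \<in> CKer" and l: "l \<in> Ker" and h: "h = b \<otimes> l"
      unfolding carrier_CKer_Ker by (auto simp: set_mult_def)
    note C = subgroup.m_closed[OF CKer_subgroup] subgroup.m_inv_closed[OF CKer_subgroup]
    note K = subgroup.m_closed[OF Ker_subgroup] subgroup.m_inv_closed[OF Ker_subgroup]
    have M: "(x \<otimes> y) \<otimes> (x' \<otimes> y') = (x \<otimes> x') \<otimes> (y \<otimes> y')"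
      if "x \<in> CKer" "y \<in> Ker" "x' \<in> CKer" "y' \<in> Ker" for x y x' y'
      by (rule commuting_product) (use that in \<open>auto simp: CKer_def Ker_carrier\<close>)
    have I: "inv (x \<otimes> y) = inv x \<otimes> inv y" if "x \<in> CKer" "y \<in> Ker" for x y
      by (rule commuting_inv_product) (use that in \<open>auto simp: CKer_def Ker_carrier\<close>)
    have "g \<otimes> h \<otimes> inv g \<otimes> inv h = (a \<otimes> b \<otimes> inv a \<otimes> inv b) \<otimes> (k \<otimes> l \<otimes> inv k \<otimes> inv l)"
      unfolding g h using a b k l by (simp only: M I C K)
    moreover have "a \<otimes> b \<otimes> inv a \<otimes> inv b \<in> derived G L"
      unfolding derived_def using a b CKer_L by (intro generate.incl) blast
    moreover have "k \<otimes> l \<otimes> inv k \<otimes> inv l \<in> Ker" using k l K by simp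
    ultimately show "g \<otimes> h \<otimes> inv g \<otimes> inv h \<in> derived G L <#> Ker"
      by (auto simp: set_mult_def)
  qed
  then have "derived G (carrier G) \<subseteq> derived G L <#> Ker"
    unfolding derived_def[of G "carrier G"] using S by (rule generate_subgroup_incl)
  then show "carrier G \<subseteq> derived G L <#> Ker" using perfect by simp
qed

text \<open>Both \<open>iota\<close> and \<open>c\<close> are equivariant, so an automorphism
  carries a witness \<open>g\<close> for \<open>y\<close> to a witness \<open>\<alpha> g\<close> for
  \<open>\<alpha> y\<close>.\<close>

lemma L_auto:
  assumes \<beta>: "\<beta> \<in> auto G"
  shows "\<beta> ` L = L"
proof (rule auto_invariantI[OF L_carrier _ \<beta>])
  fix \<alpha> assume \<alpha>: "\<alpha> \<in> auto G"
  then have B: "\<alpha> \<in> Bij (carrier G)"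
    and m: "\<And>x y. \<lbrakk>x \<in> carrier G; y \<in> carrier G\<rbrakk> \<Longrightarrow> \<alpha> (x \<otimes> y) = \<alpha> x \<otimes> \<alpha> y"
    by (auto simp: in_auto_iff)
  note cl = Bij_closed[OF B]
  have one: "\<alpha> \<one> = \<one>" using m[of \<one> \<one>] cl by simp
  have i: "\<alpha> (inv x) = inv (\<alpha> x)" if "x \<in> carrier G" for x
    by (rule inv_equality[symmetric]) (use m[of "inv x" x] cl that one in simp_all)
  show "\<alpha> ` L \<subseteq> L"
  proof clarify
    fix y assume "y \<in> L"
    then obtain g where y: "y \<in> carrier G" and g: "g \<in> carrier G" and yg: "iota G y = c g"
      by (auto simp: L_def)
    have "iota G (\<alpha> y) = c (\<alpha> g)"
    proof (rule Bij_eqI)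
      show "iota G (\<alpha> y) \<in> Bij (carrier G)" "c (\<alpha> g) \<in> Bij (carrier G)"
        using y g cl iota_auto c_Bij by (auto simp: in_auto_iff)
      fix x assume "x \<in> carrier G"
      then obtain u where u: "u \<in> carrier G" "x = \<alpha> u"
        using B by (auto simp: Bij_def bij_betw_def)
      have "iota G (\<alpha> y) x = \<alpha> (iota G y u)"
        using u y cl by (simp add: iota_def m i)
      also have "\<dots> = c (\<alpha> g) x" using c_equivariant[OF \<alpha> g u(1)] u yg by simp
      finally show "iota G (\<alpha> y) x = c (\<alpha> g) x" .
    qed
    then show "\<alpha> y \<in> L" using y g cl by (auto simp: L_def)
  qed
qed

lemma aut_subgroup_derived_L: "aut_subgroup G (derived G L)"
proof -
  have "\<alpha> ` derived G L = derived G L" if \<alpha>: "\<alpha> \<in> auto G" for \<alpha>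
  proof -
    interpret group_hom G G \<alpha>
      by unfold_locales (use \<alpha> in \<open>simp add: auto_def\<close>)
    show ?thesis using derived_img[OF L_carrier] L_auto[OF \<alpha>] by simp
  qed
  then show ?thesis using derived_is_subgroup[OF L_carrier] by (simp add: aut_subgroup_def)
qed

lemma aut_subgroup_Ker: "aut_subgroup G Ker"
  unfolding aut_subgroup_def
  by (intro conjI ballI Ker_subgroup auto_invariantI) (auto simp: Ker_auto Ker_carrier)

end

section \<open>The maps \<open>nu\<close> and \<open>gamma\<close> of a regular normal subgroup of
  the holomorph\<close>

locale reg_normal = group G for G (structure) +
  fixes N :: "('a \<Rightarrow> 'a) set"
  assumes N_mem: "N \<in> reg_normal_hol G"
begin

sublocale Sym: group "sym_group (carrier G)"
  by (rule group_sym_group)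

lemma N_subgroup: "subgroup N (sym_group (carrier G))"
  and N_regular: "regular_perms (carrier G) N"
  and N_normal: "N \<lhd> (sym_group (carrier G)) \<lparr>carrier := holomorph G\<rparr>"
  using N_mem by (auto simp: reg_normal_hol_def)

lemma N_Bij: "n \<in> N \<Longrightarrow> n \<in> Bij (carrier G)"
  using subgroup.mem_carrier[OF N_subgroup] by simp

lemma N_holomorph: "n \<in> N \<Longrightarrow> n \<in> holomorph G"
  using subgroup.mem_carrier[OF normal_imp_subgroup[OF N_normal]] by simp

text \<open>The product of \<open>n\<close> and the inverse of \<open>m\<close> fixes \<one>, and
  point stabilizers in a regular group are trivial.\<close>

lemma N_determined:
  assumes n: "n \<in> N" and m: "m \<in> N" and eq: "n \<one> = m \<one>"
  shows "n = m"
proof -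
  let ?P = "sym_group (carrier G)"
  let ?k = "n \<otimes>\<^bsub>?P\<^esub> inv\<^bsub>?P\<^esub> m"
  note nB = N_Bij[OF n] and mB = N_Bij[OF m]
  have iN: "inv\<^bsub>?P\<^esub> m \<in> N" by (rule subgroup.m_inv_closed[OF N_subgroup m])
  have kN: "?k \<in> N" by (rule subgroup.m_closed[OF N_subgroup n iN])
  have "m \<otimes>\<^bsub>?P\<^esub> inv\<^bsub>?P\<^esub> m = \<one>\<^bsub>?P\<^esub>"
    using mB by simp
  then have "(m \<otimes>\<^bsub>?P\<^esub> inv\<^bsub>?P\<^esub> m) \<one> = \<one>"
    by (simp add: sym_group_one)
  then have "?k \<one> = \<one>"
    using eq nB mB N_Bij[OF iN] by (simp add: sym_group_mult compose_def)
  then have "?k = \<one>\<^bsub>?P\<^esub>"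
    using N_regular kN by (auto simp: regular_perms_def)
  then show ?thesis
    using nB mB by (metis Sym.inv_equality Sym.inv_inv Sym.inv_closed carrier_sym_group)
qed

lemma nu_mem: "g \<in> carrier G \<Longrightarrow> nu G N g \<in> N"
  and nu_one: "g \<in> carrier G \<Longrightarrow> nu G N g \<one> = g"
proof -
  assume g: "g \<in> carrier G"
  then obtain n where "n \<in> N" "n \<one> = g"
    using N_regular unfolding regular_perms_def by (meson one_closed)
  then have "\<exists>!n. n \<in> N \<and> n \<one> = g" using N_determined by auto
  then have "nu G N g \<in> N \<and> nu G N g \<one> = g"
    unfolding nu_def by (rule theI')
  then show "nu G N g \<in> N" "nu G N g \<one> = g" by auto
qed

lemma nu_eqI: "\<lbrakk>n \<in> N; n \<one> = g; g \<in> carrier G\<rbrakk> \<Longrightarrow> nu G N g = n"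
  using N_determined nu_mem nu_one by simp

text \<open>Since \<open>nu G N g\<close> sends \<one> to \<open>g\<close>,
  \<open>holomorph_factor\<close> supplies its automorphism part; cancelling \<open>g\<close> makes
  that part unique, so the definite description is met.\<close>

lemma gamma_nu:
  assumes g: "g \<in> carrier G"
  shows "gamma G N g \<in> auto G" and "nu G N g = (\<lambda>x\<in>carrier G. gamma G N g x \<otimes> g)"
proof -
  let ?S = "carrier G" let ?n = "nu G N g"
  let ?P = "\<lambda>\<alpha>. \<alpha> \<in> auto G \<and> ?n = \<alpha> \<otimes>\<^bsub>sym_group ?S\<^esub> right_reg G g"
  note nB = N_Bij[OF nu_mem[OF g]]
  have prod: "\<alpha> \<otimes>\<^bsub>sym_group ?S\<^esub> right_reg G g = (\<lambda>x\<in>?S. \<alpha> x \<otimes> g)" if "\<alpha> \<in> auto G" for \<alpha>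
  proof -
    have a: "\<alpha> \<in> Bij ?S" using that by (simp add: in_auto_iff)
    show ?thesis
      unfolding sym_group_mult[OF a right_reg_Bij[OF g]]
      using Bij_closed[OF a] by (auto simp: compose_def right_reg_def)
  qed
  let ?a = "\<lambda>x\<in>?S. ?n x \<otimes> inv g"
  have aut: "?a \<in> auto G"
    using holomorph_factor[OF N_holomorph[OF nu_mem[OF g]]] g by (simp add: nu_one)
  have "?P ?a"
    using aut g nB Bij_closed[OF nB] extensional_arb[OF Bij_imp_extensional[OF nB]]
    by (auto simp: prod[OF aut] fun_eq_iff m_assoc)
  moreover have "\<alpha> = ?a" if "?P \<alpha>" for \<alpha>
  proof -
    have a: "\<alpha> \<in> Bij ?S" using that by (simp add: in_auto_iff)
    have "?n = (\<lambda>x\<in>?S. \<alpha> x \<otimes> g)" using that prod[of \<alpha>] by simp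
    then have "?n x = \<alpha> x \<otimes> g" if "x \<in> ?S" for x using that by simp
    then show ?thesis
      using g Bij_closed[OF a] extensional_arb[OF Bij_imp_extensional[OF a]]
      by (auto simp: fun_eq_iff m_assoc)
  qed
  ultimately have P: "?P (gamma G N g)"
    unfolding gamma_def by (rule theI)
  show aut: "gamma G N g \<in> auto G" using P by (rule conjunct1)
  show "nu G N g = (\<lambda>x\<in>?S. gamma G N g x \<otimes> g)"
    using conjunct2[OF P] unfolding prod[OF aut] .
qed

lemma nu_eq: "\<lbrakk>g \<in> carrier G; x \<in> carrier G\<rbrakk> \<Longrightarrow> nu G N g x = gamma G N g x \<otimes> g"
  by (subst gamma_nu(2)) auto

lemma gamma_Bij: "g \<in> carrier G \<Longrightarrow> gamma G N g \<in> Bij (carrier G)"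
  using gamma_nu(1) by (simp add: in_auto_iff)

text \<open>Conjugating \<open>nu G N g\<close> by \<beta> stays in \<open>N\<close> by normality,
  and the result sends \<one> to \<open>\<beta> g\<close> because \<beta> fixes \<one>. It is
  therefore \<open>nu G N (\<beta> g)\<close>, and the automorphism parts are compared.\<close>

lemma gamma_equivariant:
  assumes \<beta>: "\<beta> \<in> auto G" and g: "g \<in> carrier G" and x: "x \<in> carrier G"
  shows "gamma G N (\<beta> g) (\<beta> x) = \<beta> (gamma G N g x)"
proof -
  let ?S = "carrier G" let ?Q = "(sym_group ?S)\<lparr>carrier := holomorph G\<rparr>"
  have bB: "\<beta> \<in> Bij ?S"
    and bm: "\<And>x y. \<lbrakk>x \<in> ?S; y \<in> ?S\<rbrakk> \<Longrightarrow> \<beta> (x \<otimes> y) = \<beta> x \<otimes> \<beta> y"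
    using \<beta> by (auto simp: in_auto_iff)
  note bc = Bij_closed[OF bB] and gc = Bij_closed[OF gamma_Bij]
  have b1: "\<beta> \<one> = \<one>"
    using bm[of \<one> \<one>] bc by simp
  interpret NQ: normal N ?Q by (rule N_normal)
  have "nu G N g \<otimes>\<^bsub>sym_group ?S\<^esub> \<beta> \<in> N #>\<^bsub>?Q\<^esub> \<beta>"
    using nu_mem[OF g] by (auto simp: r_coset_def)
  then have "nu G N g \<otimes>\<^bsub>sym_group ?S\<^esub> \<beta> \<in> \<beta> <#\<^bsub>?Q\<^esub> N"
    using NQ.coset_eq auto_in_holomorph[OF \<beta>] by simp
  then obtain n where n: "n \<in> N" and "nu G N g \<otimes>\<^bsub>sym_group ?S\<^esub> \<beta> = \<beta> \<otimes>\<^bsub>sym_group ?S\<^esub> n"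
    by (auto simp: l_coset_def)
  then have *: "compose ?S \<beta> (nu G N g) = compose ?S n \<beta>"
    using bB N_Bij[OF n] N_Bij[OF nu_mem[OF g]] by (simp add: sym_group_mult)
  have eq: "\<beta> (nu G N g y) = n (\<beta> y)" if "y \<in> ?S" for y
    by (rule compose_eqD[OF * that])
  have "n = nu G N (\<beta> g)"
    using nu_eqI[OF n _ bc[OF g]] eq[of \<one>] g by (simp add: nu_one b1)
  then show ?thesis
    using eq[OF x] g x bc gc by (simp add: nu_eq bm)
qed

text \<open>A product of two values of \<open>nu\<close> is again a value of \<open>nu\<close>,
  identified by its image of \<one>; equivariance then rearranges the automorphism parts.\<close>

lemma gamma_mult:
  assumes g: "g \<in> carrier G" and h: "h \<in> carrier G" and x: "x \<in> carrier G"
  shows "gamma G N (g \<otimes> h) x = gamma G N g (gamma G N h x)"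
proof -
  let ?S = "carrier G"
  note gc = Bij_closed[OF gamma_Bij]
  \<comment> \<open>This \<open>k\<close> is chosen so that \<open>nu G N k\<close> followed by
    \<open>nu G N h\<close> sends \<one> to \<open>g \<otimes> h\<close>.\<close>
  obtain k where k: "k \<in> ?S" and gk: "g = gamma G N h k"
    using gamma_Bij[OF h] g by (auto simp: Bij_def bij_betw_def)
  have "nu G N k \<otimes>\<^bsub>sym_group ?S\<^esub> nu G N h \<in> N"
    using subgroup.m_closed[OF N_subgroup] nu_mem k h by auto
  then have N: "compose ?S (nu G N h) (nu G N k) \<in> N"
    using N_Bij nu_mem k h by (simp add: sym_group_mult)
  have "nu G N (g \<otimes> h) = compose ?S (nu G N h) (nu G N k)"
    by (rule nu_eqI[OF N]) (use g h k nu_one[OF k] nu_eq[OF h k] gk in \<open>simp_all add: compose_def\<close>)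
  then have "gamma G N (g \<otimes> h) x \<otimes> (g \<otimes> h) = compose ?S (nu G N h) (nu G N k) x"
    using g h x by (simp flip: nu_eq)
  also have "\<dots> = gamma G N h (gamma G N k x \<otimes> k) \<otimes> h"
    using h k x gc by (simp add: compose_def nu_eq)
  also have "\<dots> = gamma G N h (gamma G N k x) \<otimes> (g \<otimes> h)"
    using gamma_nu(1)[OF h] h k x gc by (simp add: in_auto_iff gk m_assoc)
  also have "gamma G N h (gamma G N k x) = gamma G N g (gamma G N h x)"
    using gamma_equivariant[OF gamma_nu(1)[OF h] k x] gk by simp
  finally show ?thesis using g h x gc by simp
qed

sublocale equivariant_gamma G "gamma G N"
  by unfold_locales (simp_all add: gamma_nu(1) gamma_mult gamma_equivariant)

lemma circ_mult: "x \<otimes>\<^bsub>circ_group G N\<^esub> y = gamma G N y x \<otimes> y"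
  by (simp add: circ_group_def)

lemma carrier_circ: "carrier (circ_group G N) = carrier G"
  by (simp add: circ_group_def)

lemma circ_one: "\<one>\<^bsub>circ_group G N\<^esub> = \<one>"
  by (simp add: circ_group_def)

lemma group_circ: "group (circ_group G N)"
proof (rule groupI, simp_all only: circ_mult carrier_circ circ_one)
  fix x y z assume x: "x \<in> carrier G" and y: "y \<in> carrier G" and z: "z \<in> carrier G"
  \<comment> \<open>Associativity amounts to this rule for \<open>gamma\<close> at the circle
    product of \<open>y\<close> and \<open>z\<close>; it follows from equivariance under
    \<open>gamma G N z\<close>.\<close>
  have "gamma G N (gamma G N z y \<otimes> z) x = gamma G N z (gamma G N y x)"
    using gamma_equivariant[OF gamma_nu(1)[OF z] y x] x y z by (simp add: gamma_mult)
  then show "gamma G N z (gamma G N y x \<otimes> y) \<otimes> z =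
      gamma G N (gamma G N z y \<otimes> z) x \<otimes> (gamma G N z y \<otimes> z)"
    using x y z by (simp add: c_hom m_assoc)
next
  fix x assume x: "x \<in> carrier G"
  then show "\<exists>y\<in>carrier G. gamma G N x y \<otimes> x = \<one>"
    \<comment> \<open>Applying \<open>gamma G N x\<close> to this witness leaves
      \<open>inv x\<close>, so it is a left inverse for the circle operation.\<close>
    by (intro bexI[of _ "gamma G N (inv x) (inv x)"]) auto
qed auto

lemma Ker_eq_kernel: "Ker = kernel G (aut_group G) (gamma G N)"
proof -
  have "gamma G N g = (\<lambda>x\<in>carrier G. x) \<longleftrightarrow> (\<forall>x\<in>carrier G. gamma G N g x = x)"
    if "g \<in> carrier G" for g
  proof
    assume "\<forall>x\<in>carrier G. gamma G N g x = x"
    then show "gamma G N g = (\<lambda>x\<in>carrier G. x)"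
      by (intro Bij_eqI[OF c_Bij[OF that] id_Bij]) simp
  qed simp
  then show ?thesis
    by (auto simp: Ker_def kernel_def aut_group_def sym_group_one)
qed

end

section \<open>Central products and the theorem\<close>

lemma central_productI:
  fixes A (structure)
  assumes "group A" and H: "subgroup H A" and K: "subgroup K A"
    and prod: "carrier A = H <#> K"
    and comm: "\<And>h k. \<lbrakk>h \<in> H; k \<in> K\<rbrakk> \<Longrightarrow> k \<otimes> h = h \<otimes> k"
  shows "central_product A H K"
proof -
  interpret group A by fact
  have "h \<otimes> k \<otimes> inv h \<otimes> inv k = \<one>" if "h \<in> H" "k \<in> K" for h k
  proof -
    have c: "h \<in> carrier A" "k \<in> carrier A"
      using that subgroup.mem_carrier[OF H] subgroup.mem_carrier[OF K] by auto
    have "h \<otimes> k \<otimes> inv h \<otimes> inv k = k \<otimes> h \<otimes> inv h \<otimes> inv k"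
      by (simp only: comm[OF that])
    then show ?thesis using c by (simp add: m_assoc inv_cancel)
  qed
  then have "(\<Union>h\<in>H. \<Union>k\<in>K. {h \<otimes> k \<otimes> inv h \<otimes> inv k}) = {\<one>}"
    using subgroup.one_closed[OF H] subgroup.one_closed[OF K] by auto
  then show ?thesis
    using assms by (simp add: central_product_def commutator_subgroup_def generate_one)
qed

theorem theorem7p5:
  fixes G :: "('a, 'b) monoid_scheme" (structure)
    and N :: "('a \<Rightarrow> 'a) set"
    and H K :: "'a set"
  assumes "group G" and "finite (carrier G)" and "perfect_group G"
    and "N \<in> reg_normal_hol G"
    and "H = derived G {y \<in> carrier G. iota G y \<in> gamma G N ` carrier G}"
    and "K = kernel G (aut_group G) (gamma G N)"
  shows
    "(central_product G H K \<and> aut_subgroup G H \<and> aut_subgroup G K) \<and>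
     (\<forall>x\<in>H. gamma G N x = iota G (inv x)) \<and>
     (central_product (circ_group G N) H K \<and>
      (\<forall>x\<in>H. \<forall>y\<in>K. \<forall>a\<in>H. \<forall>b\<in>K.
         (x \<otimes> y) \<otimes>\<^bsub>circ_group G N\<^esub> (a \<otimes> b) = (a \<otimes> x) \<otimes> (y \<otimes> b))) \<and>
     ((\<forall>x\<in>H. \<forall>y\<in>K. \<forall>a\<in>H. \<forall>b\<in>K.
         nu G N (a \<otimes> b) (x \<otimes> y) = (x \<otimes> y) \<otimes>\<^bsub>circ_group G N\<^esub> (a \<otimes> b) \<and>
         (x \<otimes> y) \<otimes>\<^bsub>circ_group G N\<^esub> (a \<otimes> b) = (a \<otimes> x) \<otimes> (y \<otimes> b)) \<and>
      (\<forall>b\<in>K. restrict (nu G N b) K = right_reg (G\<lparr>carrier := K\<rparr>) b) \<and>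
      (\<forall>a\<in>H. restrict (nu G N a) H = left_reg (G\<lparr>carrier := H\<rparr>) a))"
proof -
  interpret group G by fact
  interpret reg_normal G N
    using assms(4) by unfold_locales
  interpret perfect_gamma G "gamma G N"
    using assms(3) by unfold_locales (simp add: perfect_group_def)
  let ?O = "circ_group G N"
  have H: "H = derived G L" using assms(5) by (simp add: L_def)
  have K: "K = Ker" using assms(6) Ker_eq_kernel by simp
  have sH: "subgroup H G" unfolding H by (rule derived_is_subgroup[OF L_carrier])
  have sK: "subgroup K G" unfolding K by (rule Ker_subgroup)
  note Hc = subgroup.mem_carrier[OF sH] and Kc = subgroup.mem_carrier[OF sK]
  note H1 = subgroup.one_closed[OF sH] and K1 = subgroup.one_closed[OF sK]
  have comm: "k \<otimes> h = h \<otimes> k" if "h \<in> H" "k \<in> K" for h k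
    using derived_L_Ker_commute that by (simp add: H K)
  have prod: "carrier G = H <#> K"
    unfolding H K by (rule carrier_derived_L_Ker)
  have cH: "gamma G N x u = x \<otimes> u \<otimes> inv x" if "x \<in> H" "u \<in> carrier G" for x u
    using c_derived_L that by (simp add: H)
  \<comment> \<open>The kernel factor \<open>b\<close> acts trivially, so only conjugation by
    \<open>a\<close> remains; in the circle product its trailing \<open>inv a\<close> cancels the
    \<open>a\<close> of \<open>a \<otimes> b\<close>.\<close>
  have cHK: "gamma G N (a \<otimes> b) u = a \<otimes> u \<otimes> inv a" if "a \<in> H" "b \<in> K" "u \<in> carrier G" for a b u
  proof -
    have "gamma G N b u = u" using that by (simp add: K Ker_def)
    then show ?thesis using c_mult[OF Hc Kc] cH that by simp
  qed
  have mult: "(x \<otimes> y) \<otimes>\<^bsub>?O\<^esub> (a \<otimes> b) = (a \<otimes> x) \<otimes> (y \<otimes> b)"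
    if "x \<in> H" "y \<in> K" "a \<in> H" "b \<in> K" for x y a b
    using that Hc Kc by (simp add: circ_mult cHK m_assoc inv_cancel)
  \<comment> \<open>Padding with \<one> specializes the pair formula: the circle operation is
    opposite to that of \<open>G\<close> on \<open>H\<close> and agrees with it on
    \<open>K\<close>.\<close>
  have multH: "x \<otimes>\<^bsub>?O\<^esub> a = a \<otimes> x" if "x \<in> H" "a \<in> H" for x a
    using mult[of x \<one> a \<one>] that H1 K1 Hc by simp
  have multK: "y \<otimes>\<^bsub>?O\<^esub> b = y \<otimes> b" if "y \<in> K" "b \<in> K" for y b
    using mult[of \<one> y \<one> b] that H1 K1 Kc by simp
  have multHK: "x \<otimes>\<^bsub>?O\<^esub> b = x \<otimes> b" "b \<otimes>\<^bsub>?O\<^esub> x = x \<otimes> b" if "x \<in> H" "b \<in> K" for x b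
    using mult[of x \<one> \<one> b] mult[of \<one> b x \<one>] that H1 K1 Hc Kc by simp_all
  interpret O: group ?O by (rule group_circ)
  \<comment> \<open>Passing to the opposite multiplication keeps inverses, so \<open>H\<close>
    remains a subgroup for the circle operation.\<close>
  have invH: "inv\<^bsub>?O\<^esub> x = inv x" if "x \<in> H" for x
    by (rule O.inv_equality)
      (use that Hc multH subgroup.m_inv_closed[OF sH] in \<open>auto simp: carrier_circ circ_one\<close>)
  have invK: "inv\<^bsub>?O\<^esub> x = inv x" if "x \<in> K" for x
    by (rule O.inv_equality)
      (use that Kc multK subgroup.m_inv_closed[OF sK] in \<open>auto simp: carrier_circ circ_one\<close>)
  have oH: "subgroup H ?O"
    by (rule O.subgroupI) (use sH Hc H1 in
      \<open>auto simp: carrier_circ invH multH subgroup.m_inv_closed subgroup.m_closed\<close>)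
  have oK: "subgroup K ?O"
    by (rule O.subgroupI) (use sK Kc K1 in
      \<open>auto simp: carrier_circ invK multK subgroup.m_inv_closed subgroup.m_closed\<close>)
  have oprod: "carrier ?O = H <#>\<^bsub>?O\<^esub> K"
    by (simp add: carrier_circ prod set_mult_def multHK)
  have cent: "central_product G H K"
    by (rule central_productI[OF is_group sH sK prod comm])
  have ocent: "central_product ?O H K"
    by (rule central_productI[OF group_circ oH oK oprod]) (simp add: multHK)
  have iota: "gamma G N x = iota G (inv x)" if x: "x \<in> H" for x
  proof (rule Bij_eqI)
    show "gamma G N x \<in> Bij (carrier G)" by (rule c_Bij[OF Hc[OF x]])
    show "iota G (inv x) \<in> Bij (carrier G)"
      using iota_auto[of "inv x"] Hc[OF x] by (simp add: in_auto_iff)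
  qed (use x Hc[OF x] cH in \<open>simp add: iota_def\<close>)
  have nu: "nu G N g u = u \<otimes>\<^bsub>?O\<^esub> g" if "g \<in> carrier G" "u \<in> carrier G" for g u
    using that by (simp add: nu_eq circ_mult)
  have nuHK: "nu G N (a \<otimes> b) (x \<otimes> y) = (x \<otimes> y) \<otimes>\<^bsub>?O\<^esub> (a \<otimes> b)"
    if "x \<in> H" "y \<in> K" "a \<in> H" "b \<in> K" for x y a b
    using that Hc Kc by (intro nu) auto
  have right: "restrict (nu G N b) K = right_reg (G\<lparr>carrier := K\<rparr>) b" if "b \<in> K" for b
    using that Kc by (auto simp: right_reg_def nu multK)
  have left: "restrict (nu G N a) H = left_reg (G\<lparr>carrier := H\<rparr>) a" if "a \<in> H" for a
    using that Hc by (auto simp: left_reg_def nu multH)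
  show ?thesis
    using cent ocent iota mult nuHK right left aut_subgroup_derived_L aut_subgroup_Ker
    by (simp add: H[symmetric] K[symmetric])
qed

end
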